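(* Let $(H,G)$ be a crossed module of topological groups. Two $(H,G)$ bispaces $X$ and $Y$ are isomorphic if and only if they have the same type, i.e. $\operatorname{Type}(X)=\operatorname{Type}(Y)$ in $H/t(G)$.
   Context: A crossed module $(H,G)$ consists of topological groups $G,H$ and homomorphisms $t\colon G\to H$ (continuous) and $\alpha\colon H\to\operatorname{Aut}(G)$ (giving a continuous action of $H$ on $G$) with $t(\alpha(h)(g))=h\,t(g)\,h^{-1}$ and $\alpha(t(g))(g')=gg'g^{-1}$. Then $t(G)$ is normal in $H$. A right $G$-space here means a nonempty space with a free and transitive continuous right $G$-action, such that each orbit map $g\mapsto xg$ is a homeomorphism $G\to X$ (a $G$-torsor). An $(H,G)$ bispace is a pair $(X,\psi)$ of a right $G$-space $X$ and a continuous structure map $\psi\colon X\to H$ with $\psi(xg)=\psi(x)t(g)$. A morphism of $(H,G)$ bispaces is a map commuting with the right $G$-actions and the structure maps; every morphism is an isomorphism. The type of $(X,\psi)$ is the element $\operatorname{Type}(X)=[\psi(x)]\in H/t(G)$, which is independent of $x\in X$. *)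

theory Defs
  imports
    "HOL-Algebra.Bij"
    "HOL-Algebra.Coset"
    "HOL-Analysis.Product_Topology"
begin

section \<open>Crossed modules of topological groups\<close>

record 'a top_monoid = "'a monoid" +
  top_of :: "'a topology"

locale topological_group = group G for G :: "('a, 'm) top_monoid_scheme" (structure) +
  assumes topspace_eq: "topspace (top_of G) = carrier G"
    and continuous_mult:
      "continuous_map (prod_topology (top_of G) (top_of G)) (top_of G) (\<lambda>(x, y). x \<otimes> y)"
    and continuous_inv: "continuous_map (top_of G) (top_of G) (\<lambda>x. inv x)"

text \<open>No topology is put on \<open>AutoGroup G\<close>: continuity of \<open>\<alpha>\<close> means joint continuity of the
  action \<open>H \<times> G \<rightarrow> G\<close>. In particular each \<open>\<alpha> h\<close> is then a homeomorphism of \<open>G\<close>, so nothing is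
  lost by using the automorphism group of the underlying abstract group.\<close>

locale crossed_module = G: topological_group G + H: topological_group H
  for G :: "('g, 'm) top_monoid_scheme" and H :: "('h, 'n) top_monoid_scheme" +
  fixes t :: "'g \<Rightarrow> 'h" and \<alpha> :: "'h \<Rightarrow> 'g \<Rightarrow> 'g"
  assumes t_hom: "t \<in> hom G H"
    and t_continuous: "continuous_map (top_of G) (top_of H) t"
    and \<alpha>_hom: "\<alpha> \<in> hom H (AutoGroup G)"
    and \<alpha>_continuous:
      "continuous_map (prod_topology (top_of H) (top_of G)) (top_of G) (\<lambda>(h, g). \<alpha> h g)"
    and t_\<alpha>: "\<lbrakk>h \<in> carrier H; g \<in> carrier G\<rbrakk> \<Longrightarrow>
      t (\<alpha> h g) = h \<otimes>\<^bsub>H\<^esub> t g \<otimes>\<^bsub>H\<^esub> inv\<^bsub>H\<^esub> h"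
    and \<alpha>_t: "\<lbrakk>g \<in> carrier G; g' \<in> carrier G\<rbrakk> \<Longrightarrow>
      \<alpha> (t g) g' = g \<otimes>\<^bsub>G\<^esub> g' \<otimes>\<^bsub>G\<^esub> inv\<^bsub>G\<^esub> g"

lemma (in crossed_module) image_normal: "t ` carrier G \<lhd> H"
proof -
  interpret t: group_hom G H t
    by (simp add: group_hom_def group_hom_axioms_def t_hom G.group_axioms H.group_axioms)
  show ?thesis
  proof (rule H.normal_invI)
    show "subgroup (t ` carrier G) H" by (rule t.img_is_subgroup)
    fix h k assume h: "h \<in> carrier H" and "k \<in> t ` carrier G"
    then obtain g where g: "g \<in> carrier G" "k = t g" by blast
    have "\<alpha> h \<in> auto G"
      using \<alpha>_hom h by (auto simp: hom_def AutoGroup_def)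
    then have "\<alpha> h g \<in> carrier G"
      using g(1) by (auto simp: auto_def hom_def)
    then show "h \<otimes>\<^bsub>H\<^esub> k \<otimes>\<^bsub>H\<^esub> inv\<^bsub>H\<^esub> h \<in> t ` carrier G"
      unfolding g(2) t_\<alpha>[OF h g(1), symmetric] by (rule imageI)
  qed
qed

section \<open>Bispaces\<close>

record ('x, 'g, 'h) bispace =
  space_of :: "'x topology"
  act :: "'x \<Rightarrow> 'g \<Rightarrow> 'x"
  str :: "'x \<Rightarrow> 'h"

definition right_G_space ::
    "('g, 'm) top_monoid_scheme \<Rightarrow> 'x topology \<Rightarrow> ('x \<Rightarrow> 'g \<Rightarrow> 'x) \<Rightarrow> bool" where
  "right_G_space G X a \<longleftrightarrow>
     topspace X \<noteq> {} \<and>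
     continuous_map (prod_topology X (top_of G)) X (\<lambda>(x, g). a x g) \<and>
     (\<forall>x\<in>topspace X. a x \<one>\<^bsub>G\<^esub> = x) \<and>
     (\<forall>x\<in>topspace X. \<forall>g\<in>carrier G. \<forall>g'\<in>carrier G. a (a x g) g' = a x (g \<otimes>\<^bsub>G\<^esub> g')) \<and>
     (\<forall>x\<in>topspace X. \<forall>g\<in>carrier G. a x g = x \<longrightarrow> g = \<one>\<^bsub>G\<^esub>) \<and>
     (\<forall>x\<in>topspace X. \<forall>y\<in>topspace X. \<exists>g\<in>carrier G. y = a x g) \<and>
     (\<forall>x\<in>topspace X. homeomorphic_map (top_of G) X (a x))"

definition is_bispace ::
    "('g, 'm) top_monoid_scheme \<Rightarrow> ('h, 'n) top_monoid_scheme \<Rightarrow> ('g \<Rightarrow> 'h) \<Rightarrow>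
     ('x, 'g, 'h) bispace \<Rightarrow> bool" where
  "is_bispace G H t X \<longleftrightarrow>
     right_G_space G (space_of X) (act X) \<and>
     continuous_map (space_of X) (top_of H) (str X) \<and>
     (\<forall>x\<in>topspace (space_of X). \<forall>g\<in>carrier G. str X (act X x g) = str X x \<otimes>\<^bsub>H\<^esub> t g)"

definition bispace_morphism ::
    "('g, 'm) top_monoid_scheme \<Rightarrow> ('x, 'g, 'h) bispace \<Rightarrow> ('y, 'g, 'h) bispace \<Rightarrow>
     ('x \<Rightarrow> 'y) \<Rightarrow> bool" where
  "bispace_morphism G X Y f \<longleftrightarrow>
     continuous_map (space_of X) (space_of Y) f \<and>
     (\<forall>x\<in>topspace (space_of X). \<forall>g\<in>carrier G. f (act X x g) = act Y (f x) g) \<and>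
     (\<forall>x\<in>topspace (space_of X). str Y (f x) = str X x)"

definition bispace_isomorphic ::
    "('g, 'm) top_monoid_scheme \<Rightarrow> ('x, 'g, 'h) bispace \<Rightarrow> ('y, 'g, 'h) bispace \<Rightarrow> bool" where
  "bispace_isomorphic G X Y \<longleftrightarrow>
     (\<exists>f f'. bispace_morphism G X Y f \<and> bispace_morphism G Y X f' \<and>
        (\<forall>x\<in>topspace (space_of X). f' (f x) = x) \<and>
        (\<forall>y\<in>topspace (space_of Y). f (f' y) = y))"

text \<open>The quotient \<open>H / t(G)\<close> is the library's \<open>H Mod t ` carrier G\<close>, whose elements are right
  cosets. As \<open>t ` carrier G\<close> is normal (\<open>image_normal\<close>), these are also the left cosets; the
  lemmas below show that the choice of point is immaterial.\<close>

definition bispace_type ::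
    "('g, 'm) top_monoid_scheme \<Rightarrow> ('h, 'n) top_monoid_scheme \<Rightarrow> ('g \<Rightarrow> 'h) \<Rightarrow>
     ('x, 'g, 'h) bispace \<Rightarrow> 'h set" where
  "bispace_type G H t X =
     (THE c. \<exists>x\<in>topspace (space_of X). c = t ` carrier G #>\<^bsub>H\<^esub> str X x)"

context crossed_module
begin

lemma bispace_type_eq:
  assumes X: "is_bispace G H t X" and x: "x \<in> topspace (space_of X)"
  shows "bispace_type G H t X = t ` carrier G #>\<^bsub>H\<^esub> str X x"
proof -
  interpret N: normal "t ` carrier G" H by (rule image_normal)
  have str: "str X y \<in> carrier H" if "y \<in> topspace (space_of X)" for y
  proof -
    have "continuous_map (space_of X) (top_of H) (str X)"
      using X by (simp add: is_bispace_def)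
    then show ?thesis
      using that unfolding H.topspace_eq[symmetric] continuous_map_def by blast
  qed
  have "t ` carrier G #>\<^bsub>H\<^esub> str X y = t ` carrier G #>\<^bsub>H\<^esub> str X x"
    if y: "y \<in> topspace (space_of X)" for y
  proof -
    obtain g where g: "g \<in> carrier G" "y = act X x g"
      using X x y unfolding is_bispace_def right_G_space_def by blast
    then have "str X y = str X x \<otimes>\<^bsub>H\<^esub> t g"
      using X x unfolding is_bispace_def by blast
    then have "str X y \<in> str X x <#\<^bsub>H\<^esub> t ` carrier G"
      using g unfolding l_coset_def by blast
    then have "str X y \<in> t ` carrier G #>\<^bsub>H\<^esub> str X x"
      using N.coset_eq str[OF x] by blast
    then show ?thesis
      using H.repr_independence[OF _ str[OF x] N.subgroup_axioms] by simp
  qed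
  with x show ?thesis
    unfolding bispace_type_def by (intro the_equality) blast+
qed

lemma bispace_type_in_quotient:
  assumes X: "is_bispace G H t X"
  shows "bispace_type G H t X \<in> carrier (H Mod t ` carrier G)"
proof -
  obtain x where x: "x \<in> topspace (space_of X)"
    using X unfolding is_bispace_def right_G_space_def by blast
  moreover have "continuous_map (space_of X) (top_of H) (str X)"
    using X by (simp add: is_bispace_def)
  ultimately have "str X x \<in> carrier H"
    unfolding H.topspace_eq[symmetric] continuous_map_def by blast
  then show ?thesis
    by (auto simp: bispace_type_eq[OF X x] FactGroup_def RCOSETS_def)
qed

end

end

theory Submission
  imports Defs
begin

text \<open>If \<open>X\<close> and \<open>Y\<close> have the same type, then moving a point of \<open>Y\<close> along its orbit gives
  \<open>x \<in> X\<close> and \<open>y \<in> Y\<close> with the same structure value. As the orbit maps \<open>g \<mapsto> xg\<close> and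
  \<open>g \<mapsto> yg\<close> are homeomorphisms, \<open>xg \<mapsto> yg\<close> is an isomorphism. Conversely, an isomorphism
  preserves structure values, hence the type.\<close>

context crossed_module
begin

text \<open>The orbit map at \<open>x\<close> is a homeomorphism onto the whole space, so its values
  lie in the space.\<close>

lemma act_closed:
  assumes "is_bispace G H t X" and "x \<in> topspace (space_of X)" and "g \<in> carrier G"
  shows "act X x g \<in> topspace (space_of X)"
proof -
  have "homeomorphic_map (top_of G) (space_of X) (act X x)"
    using assms(1,2) by (simp add: is_bispace_def right_G_space_def)
  then show ?thesis
    using assms(3) homeomorphic_imp_surjective_map G.topspace_eq by blast
qed

lemma str_closed:
  assumes "is_bispace G H t X" and "x \<in> topspace (space_of X)"
  shows "str X x \<in> carrier H"
proof -
  have "continuous_map (space_of X) (top_of H) (str X)"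
    using assms(1) by (simp add: is_bispace_def)
  then show ?thesis
    using assms(2) unfolding H.topspace_eq[symmetric] continuous_map_def by blast
qed

lemma bispace_cases:
  assumes "is_bispace G H t X" and "x \<in> topspace (space_of X)" and "z \<in> topspace (space_of X)"
  obtains g where "g \<in> carrier G" and "z = act X x g"
  using assms unfolding is_bispace_def right_G_space_def by blast

text \<open>Freeness makes sending \<open>act X x g\<close> to \<open>act Y y g\<close> unambiguous,
  and equal structure values at the base points make it respect the structure maps. By transitivity
  the second conclusion determines \<open>f\<close> on all of \<open>X\<close>, which later
  identifies inverses.\<close>

lemma bispace_morphism_exists:
  assumes X: "is_bispace G H t X" and Y: "is_bispace G H t Y"
    and x: "x \<in> topspace (space_of X)" and y: "y \<in> topspace (space_of Y)"
    and eq: "str X x = str Y y"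
  obtains f where "bispace_morphism G X Y f" and "\<And>g. g \<in> carrier G \<Longrightarrow> f (act X x g) = act Y y g"
proof -
  have "homeomorphic_map (top_of G) (space_of X) (act X x)"
    using X x by (simp add: is_bispace_def right_G_space_def)
  then obtain i where i: "homeomorphic_maps (top_of G) (space_of X) (act X x) i"
    using homeomorphic_map_maps by blast
  \<comment> \<open>\<open>i\<close> reads off the group coordinate of a point relative to
    \<open>x\<close>; continuity of \<open>f\<close> comes from that of \<open>i\<close> and of the
    orbit map at \<open>y\<close>.\<close>
  define f where "f = act Y y \<circ> i"
  have f: "f (act X x g) = act Y y g" if "g \<in> carrier G" for g
    using i that by (simp add: f_def homeomorphic_maps_def G.topspace_eq)
  have "homeomorphic_map (top_of G) (space_of Y) (act Y y)"
    using Y y by (simp add: is_bispace_def right_G_space_def)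
  then have "continuous_map (space_of X) (space_of Y) f"
    unfolding f_def using i homeomorphic_imp_continuous_map
    by (auto simp: homeomorphic_maps_def intro: continuous_map_compose)
  moreover have "f (act X z g) = act Y (f z) g"
    if z: "z \<in> topspace (space_of X)" and g: "g \<in> carrier G" for z g
  proof -
    obtain k where k: "k \<in> carrier G" "z = act X x k"
      using bispace_cases[OF X x z] .
    \<comment> \<open>In coordinates relative to \<open>x\<close> and \<open>y\<close>, acting by
      \<open>g\<close> is right multiplication of \<open>k\<close> by \<open>g\<close> on both
      sides.\<close>
    have "act X z g = act X x (k \<otimes>\<^bsub>G\<^esub> g)"
      using X x k g by (simp add: is_bispace_def right_G_space_def)
    moreover have "act Y (act Y y k) g = act Y y (k \<otimes>\<^bsub>G\<^esub> g)"
      using Y y k(1) g by (simp add: is_bispace_def right_G_space_def)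
    ultimately show ?thesis
      using k g f by simp
  qed
  moreover have "str Y (f z) = str X z" if z: "z \<in> topspace (space_of X)" for z
  proof -
    obtain k where k: "k \<in> carrier G" "z = act X x k"
      using bispace_cases[OF X x z] .
    \<comment> \<open>Both sides equal \<open>str X x\<close> times \<open>t k\<close>, by
      \<open>eq\<close>.\<close>
    then show ?thesis
      using X Y x y eq f by (simp add: is_bispace_def)
  qed
  ultimately show thesis
    using f by (intro that[of f]) (simp_all add: bispace_morphism_def)
qed

lemma bispace_isomorphic_if_str_eq:
  assumes X: "is_bispace G H t X" and Y: "is_bispace G H t Y"
    and x: "x \<in> topspace (space_of X)" and y: "y \<in> topspace (space_of Y)"
    and eq: "str X x = str Y y"
  shows "bispace_isomorphic G X Y"
proof -
  obtain f where f: "bispace_morphism G X Y f"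
      "\<And>g. g \<in> carrier G \<Longrightarrow> f (act X x g) = act Y y g"
    using bispace_morphism_exists[OF X Y x y eq] by blast
  obtain f' where f': "bispace_morphism G Y X f'"
      "\<And>g. g \<in> carrier G \<Longrightarrow> f' (act Y y g) = act X x g"
    using bispace_morphism_exists[OF Y X y x eq[symmetric]] by blast
  \<comment> \<open>Both maps preserve the coordinate \<open>g\<close>, so their composite fixes
    every point of the orbit of \<open>x\<close>, which is all of \<open>X\<close>.\<close>
  have "f' (f z) = z" if "z \<in> topspace (space_of X)" for z
    using bispace_cases[OF X x that] f(2) f'(2) by metis
  moreover have "f (f' z) = z" if "z \<in> topspace (space_of Y)" for z
    using bispace_cases[OF Y y that] f(2) f'(2) by metis
  ultimately show ?thesis
    using f(1) f'(1) unfolding bispace_isomorphic_def by blast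
qed

text \<open>The type can be computed at any point: using \<open>x\<close> in \<open>X\<close> and
  \<open>f x\<close> in \<open>Y\<close> gives the same coset representative.\<close>

lemma bispace_type_eq_if_isomorphic:
  assumes X: "is_bispace G H t X" and Y: "is_bispace G H t Y"
    and iso: "bispace_isomorphic G X Y"
  shows "bispace_type G H t X = bispace_type G H t Y"
proof -
  obtain f where f: "bispace_morphism G X Y f"
    using iso unfolding bispace_isomorphic_def by blast
  obtain x where x: "x \<in> topspace (space_of X)"
    using X unfolding is_bispace_def right_G_space_def by blast
  have "f x \<in> topspace (space_of Y)" and "str Y (f x) = str X x"
    using f x unfolding bispace_morphism_def continuous_map_def by blast+
  then show ?thesis
    using bispace_type_eq[OF X x] bispace_type_eq[OF Y] by simp
qed

lemma bispace_isomorphic_if_type_eq: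
  assumes X: "is_bispace G H t X" and Y: "is_bispace G H t Y"
    and eq: "bispace_type G H t X = bispace_type G H t Y"
  shows "bispace_isomorphic G X Y"
proof -
  interpret N: normal "t ` carrier G" H by (rule image_normal)
  obtain x where x: "x \<in> topspace (space_of X)"
    using X unfolding is_bispace_def right_G_space_def by blast
  obtain y where y: "y \<in> topspace (space_of Y)"
    using Y unfolding is_bispace_def right_G_space_def by blast
  have "str X x \<in> t ` carrier G #>\<^bsub>H\<^esub> str X x"
    using H.rcos_self[OF str_closed[OF X x] N.subgroup_axioms] .
  \<comment> \<open>Types are right cosets, but the action changes \<open>str Y y\<close> by a
    factor on the right; normality of the image of \<open>t\<close> passes to the left
    coset.\<close>
  also have "\<dots> = str Y y <#\<^bsub>H\<^esub> t ` carrier G"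
    using eq bispace_type_eq[OF X x] bispace_type_eq[OF Y y] N.coset_eq str_closed[OF Y y] by simp
  finally obtain g where g: "g \<in> carrier G" "str X x = str Y y \<otimes>\<^bsub>H\<^esub> t g"
    unfolding l_coset_def by blast
  \<comment> \<open>Translating \<open>y\<close> by \<open>g\<close> absorbs the factor
    \<open>t g\<close>, giving base points with equal structure values.\<close>
  then have "str X x = str Y (act Y y g)"
    using Y y by (simp add: is_bispace_def)
  then show ?thesis
    using bispace_isomorphic_if_str_eq[OF X Y x act_closed[OF Y y g(1)]] by blast
qed

end

theorem proposition2p6:
  fixes G :: "('g, 'm) top_monoid_scheme" and H :: "('h, 'n) top_monoid_scheme"
    and t :: "'g \<Rightarrow> 'h" and \<alpha> :: "'h \<Rightarrow> 'g \<Rightarrow> 'g"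
    and X :: "('x, 'g, 'h) bispace" and Y :: "('y, 'g, 'h) bispace"
  assumes "crossed_module G H t \<alpha>"
    and "is_bispace G H t X" and "is_bispace G H t Y"
  shows "bispace_isomorphic G X Y \<longleftrightarrow> bispace_type G H t X = bispace_type G H t Y"
  using crossed_module.bispace_type_eq_if_isomorphic[OF assms]
    crossed_module.bispace_isomorphic_if_type_eq[OF assms] by blast

end
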